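(* Let $\mathbf{T}_{AB}$ be a reflection-symmetric interface Toeplitz operator with building block $\mathbf{T}_A$. Then $$\sigma(\mathbf{T}_A)\subseteq\sigma(\mathbf{T}_{AB}).$$ Moreover, if $\mathbf{v}$ is an eigenvector of $\mathbf{T}_A$ with $\mathbf{T}_A\mathbf{v}=\lambda\mathbf{v}$ and $\mathbf{v}_1\ne0$, then there exists an eigenvector $\mathbf{w}$ with $\mathbf{T}_{AB}\mathbf{w}=\lambda\mathbf{w}$, given explicitly by $$\mathbf{w}_i=\begin{cases}-\mathbf{v}_{|i|},&i<0,\\0,&i=0,\\\mathbf{v}_i,&i>0.\end{cases}$$
   Context: Let $k\ge1$, $a_1,\dots,a_k\in\mathbb{C}$ and $b_1,\dots,b_k\in\mathbb{C}\setminus\{0\}$, extended $k$-periodically in the index. The symmetric tridiagonal $k$-Toeplitz operator $\mathbf{T}_A$ on $\ell^2(\mathbb{N})$, $\mathbb{N}=\{1,2,\dots\}$, has entries $(\mathbf{T}_A)_{n,n}=a_n$, $(\mathbf{T}_A)_{n,n+1}=(\mathbf{T}_A)_{n+1,n}=b_n$, all others zero. Entries are complex; no Hermitian assumption is made. The reflection-symmetric interface Toeplitz operator $\mathbf{T}_{AB}$ with building block $\mathbf{T}_A$ and parameters $\eta\in\mathbb{C}$, $q\in\mathbb{C}\setminus\{0\}$ is the bounded operator on $\ell^2(\mathbb{Z})$ with entries $(\mathbf{T}_{AB})_{0,0}=\eta$; $(\mathbf{T}_{AB})_{0,1}=(\mathbf{T}_{AB})_{1,0}=(\mathbf{T}_{AB})_{0,-1}=(\mathbf{T}_{AB})_{-1,0}=q$;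 $(\mathbf{T}_{AB})_{i,j}=(\mathbf{T}_A)_{i,j}$ and $(\mathbf{T}_{AB})_{-i,-j}=(\mathbf{T}_A)_{i,j}$ for $i,j\ge1$; all other entries zero. In particular $(\mathbf{T}_{AB})_{i,j}=(\mathbf{T}_{AB})_{-i,-j}$. *)

theory Defs
  imports "HOL-Analysis.Analysis"
begin

section \<open>Bounded operators on square-summable families\<close>

text \<open>
  The space \<open>\<ell>\<^sup>2(I)\<close> is a set of total functions vanishing outside \<open>I\<close>, so that equality in
  \<open>\<ell>\<^sup>2(I)\<close> is equality of functions.
\<close>

definition ell2 :: "'i set \<Rightarrow> ('i \<Rightarrow> complex) set" where
  "ell2 I = {f. (\<forall>i. i \<notin> I \<longrightarrow> f i = 0) \<and> (\<lambda>i. (cmod (f i))\<^sup>2) summable_on I}"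

definition ell2_norm :: "'i set \<Rightarrow> ('i \<Rightarrow> complex) \<Rightarrow> real" where
  "ell2_norm I f = sqrt (\<Sum>\<^sub>\<infinity>i\<in>I. (cmod (f i))\<^sup>2)"

definition bounded_op :: "'i set \<Rightarrow> (('i \<Rightarrow> complex) \<Rightarrow> ('i \<Rightarrow> complex)) \<Rightarrow> bool" where
  "bounded_op I T \<longleftrightarrow>
     (\<forall>f\<in>ell2 I. T f \<in> ell2 I) \<and>
     (\<forall>f\<in>ell2 I. \<forall>g\<in>ell2 I. T (\<lambda>i. f i + g i) = (\<lambda>i. T f i + T g i)) \<and>
     (\<forall>c. \<forall>f\<in>ell2 I. T (\<lambda>i. c * f i) = (\<lambda>i. c * T f i)) \<and>
     (\<exists>C. \<forall>f\<in>ell2 I. ell2_norm I (T f) \<le> C * ell2_norm I f)"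

definition op_invertible :: "'i set \<Rightarrow> (('i \<Rightarrow> complex) \<Rightarrow> ('i \<Rightarrow> complex)) \<Rightarrow> bool" where
  "op_invertible I T \<longleftrightarrow>
     (\<exists>S. bounded_op I S \<and> (\<forall>f\<in>ell2 I. S (T f) = f \<and> T (S f) = f))"

definition op_spectrum :: "'i set \<Rightarrow> (('i \<Rightarrow> complex) \<Rightarrow> ('i \<Rightarrow> complex)) \<Rightarrow> complex set" where
  "op_spectrum I T = {\<mu>. \<not> op_invertible I (\<lambda>f i. T f i - \<mu> * f i)}"

definition eigenvector_of ::
    "'i set \<Rightarrow> (('i \<Rightarrow> complex) \<Rightarrow> ('i \<Rightarrow> complex)) \<Rightarrow> complex \<Rightarrow> ('i \<Rightarrow> complex) \<Rightarrow> bool" where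
  "eigenvector_of I T \<mu> v \<longleftrightarrow> v \<in> ell2 I \<and> v \<noteq> (\<lambda>i. 0) \<and> T v = (\<lambda>i. \<mu> * v i)"

definition matrix_op ::
    "'i set \<Rightarrow> ('i \<Rightarrow> 'i \<Rightarrow> complex) \<Rightarrow> ('i \<Rightarrow> complex) \<Rightarrow> ('i \<Rightarrow> complex)" where
  "matrix_op I M f = (\<lambda>i. if i \<in> I then \<Sum>\<^sub>\<infinity>j\<in>I. M i j * f j else 0)"


section \<open>Toeplitz and interface operators\<close>

text \<open>The \<open>k\<close>-periodic extension of \<open>c 1, \<dots>, c k\<close> to all indices \<open>n \<ge> 1\<close>.\<close>

definition periodic_ext :: "nat \<Rightarrow> (nat \<Rightarrow> complex) \<Rightarrow> nat \<Rightarrow> complex" where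
  "periodic_ext k c n = c ((n - 1) mod k + 1)"

definition toeplitz_entry ::
    "nat \<Rightarrow> (nat \<Rightarrow> complex) \<Rightarrow> (nat \<Rightarrow> complex) \<Rightarrow> nat \<Rightarrow> nat \<Rightarrow> complex" where
  "toeplitz_entry k a b m n =
     (if m = n then periodic_ext k a n
      else if n = m + 1 then periodic_ext k b m
      else if m = n + 1 then periodic_ext k b n
      else 0)"

definition toeplitz_op ::
    "nat \<Rightarrow> (nat \<Rightarrow> complex) \<Rightarrow> (nat \<Rightarrow> complex) \<Rightarrow> (nat \<Rightarrow> complex) \<Rightarrow> (nat \<Rightarrow> complex)" where
  "toeplitz_op k a b = matrix_op {1..} (toeplitz_entry k a b)"

definition interface_entry ::
    "nat \<Rightarrow> (nat \<Rightarrow> complex) \<Rightarrow> (nat \<Rightarrow> complex) \<Rightarrow> complex \<Rightarrow> complex \<Rightarrow> int \<Rightarrow> int \<Rightarrow> complex" where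
  "interface_entry k a b \<eta> q i j =
     (if i = 0 \<and> j = 0 then \<eta>
      else if (i, j) \<in> {(0, 1), (1, 0), (0, -1), (-1, 0)} then q
      else if i \<ge> 1 \<and> j \<ge> 1 then toeplitz_entry k a b (nat i) (nat j)
      else if i \<le> -1 \<and> j \<le> -1 then toeplitz_entry k a b (nat (- i)) (nat (- j))
      else 0)"

definition interface_op ::
    "nat \<Rightarrow> (nat \<Rightarrow> complex) \<Rightarrow> (nat \<Rightarrow> complex) \<Rightarrow> complex \<Rightarrow> complex \<Rightarrow>
       (int \<Rightarrow> complex) \<Rightarrow> (int \<Rightarrow> complex)" where
  "interface_op k a b \<eta> q = matrix_op UNIV (interface_entry k a b \<eta> q)"


section \<open>Both operators are bounded\<close>

lemma ell2_zero_outside: "f \<in> ell2 I \<Longrightarrow> i \<notin> I \<Longrightarrow> f i = 0"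
  by (simp add: ell2_def)

lemma ell2_reindex:
  assumes f: "f \<in> ell2 I" and g: "inj_on g I"
  shows "(\<lambda>i. (cmod (f (g i)))\<^sup>2) summable_on I"
    and "(\<Sum>\<^sub>\<infinity>i\<in>I. (cmod (f (g i)))\<^sup>2) \<le> (\<Sum>\<^sub>\<infinity>i\<in>I. (cmod (f i))\<^sup>2)"
proof -
  let ?F = "\<lambda>i. (cmod (f i))\<^sup>2"
  have sI: "?F summable_on I"
    using f by (simp add: ell2_def)
  have "?F summable_on UNIV \<longleftrightarrow> ?F summable_on I"
    by (rule summable_on_cong_neutral) (auto simp: ell2_zero_outside[OF f])
  then have s: "?F summable_on (g ` I)"
    using sI summable_on_subset_banach by blast
  then show "(\<lambda>i. (cmod (f (g i)))\<^sup>2) summable_on I"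
    using summable_on_reindex[OF g, of ?F] by (simp add: o_def)
  have "infsum ?F (g ` I) \<le> infsum ?F I"
    by (rule infsum_mono_neutral[OF s sI]) (auto simp: ell2_zero_outside[OF f])
  then show "(\<Sum>\<^sub>\<infinity>i\<in>I. (cmod (f (g i)))\<^sup>2) \<le> (\<Sum>\<^sub>\<infinity>i\<in>I. (cmod (f i))\<^sup>2)"
    using infsum_reindex[OF g, of ?F] by (simp add: o_def)
qed

lemma has_sum_finite_sum:
  fixes h :: "'g \<Rightarrow> 'i \<Rightarrow> real"
  assumes "finite G" "\<And>g. g \<in> G \<Longrightarrow> (h g has_sum S g) A"
  shows "((\<lambda>i. \<Sum>g\<in>G. h g i) has_sum (\<Sum>g\<in>G. S g)) A"
  using assms by (induction G rule: finite_induct) (simp_all add: has_sum_add)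

lemma bounded_op_matrix_op:
  fixes G :: "('i \<Rightarrow> 'i) set"
  assumes G: "finite G" "\<And>g. g \<in> G \<Longrightarrow> inj_on g I"
    and M: "\<And>i j. i \<in> I \<Longrightarrow> j \<in> I \<Longrightarrow> M i j \<noteq> 0 \<Longrightarrow> \<exists>g\<in>G. j = g i"
    and C: "\<And>i j. cmod (M i j) \<le> C"
  shows "bounded_op I (matrix_op I M)"
proof -
  have row: "matrix_op I M f i = (\<Sum>j\<in>(\<lambda>g. g i) ` G. M i j * f j)"
    if "i \<in> I" "\<And>j. j \<notin> I \<Longrightarrow> f j = 0" for i f
  proof -
    have "infsum (\<lambda>j. M i j * f j) I = infsum (\<lambda>j. M i j * f j) ((\<lambda>g. g i) ` G)"
      by (rule infsum_cong_neutral) (use that M in auto)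
    then show ?thesis
      using that G(1) by (simp add: matrix_op_def)
  qed
  have outside: "matrix_op I M f i = 0" if "i \<notin> I" for f i
    using that by (simp add: matrix_op_def)
  have C0: "0 \<le> C"
    using C norm_ge_zero order_trans by blast
  let ?K = "C\<^sup>2 * real (card G)"
  have pt: "(cmod (matrix_op I M f i))\<^sup>2 \<le> ?K * (\<Sum>g\<in>G. (cmod (f (g i)))\<^sup>2)"
    if f: "f \<in> ell2 I" and i: "i \<in> I" for f i
  proof -
    have "cmod (matrix_op I M f i) \<le> (\<Sum>j\<in>(\<lambda>g. g i) ` G. cmod (M i j * f j))"
      using row[OF i, of f] ell2_zero_outside[OF f] by (simp add: norm_sum)
    also have "\<dots> \<le> (\<Sum>j\<in>(\<lambda>g. g i) ` G. C * cmod (f j))"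
      by (intro sum_mono) (simp add: norm_mult mult_right_mono C)
    also have "\<dots> \<le> (\<Sum>g\<in>G. C * cmod (f (g i)))"
      using sum_image_le[OF G(1), of "\<lambda>j. C * cmod (f j)" "\<lambda>g. g i"] C0 by (simp add: o_def)
    finally have "(cmod (matrix_op I M f i))\<^sup>2 \<le> (\<Sum>g\<in>G. C * cmod (f (g i)))\<^sup>2"
      by (intro power_mono) auto
    also have "\<dots> \<le> (\<Sum>g\<in>G. (C * cmod (f (g i)))\<^sup>2) * card G"
      by (rule sum_squared_le_sum_of_squares)
    also have "\<dots> = ?K * (\<Sum>g\<in>G. (cmod (f (g i)))\<^sup>2)"
      by (simp add: power_mult_distrib sum_distrib_left[symmetric] mult_ac)
    finally show ?thesis .
  qed
  have sums: "((\<lambda>i. \<Sum>g\<in>G. (cmod (f (g i)))\<^sup>2) has_sum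
      (\<Sum>g\<in>G. \<Sum>\<^sub>\<infinity>i\<in>I. (cmod (f (g i)))\<^sup>2)) I" if f: "f \<in> ell2 I" for f
    by (rule has_sum_finite_sum[OF G(1)]) (intro has_sum_infsum ell2_reindex(1)[OF f] G(2))
  have sum_rhs: "(\<lambda>i. ?K * (\<Sum>g\<in>G. (cmod (f (g i)))\<^sup>2)) summable_on I" if f: "f \<in> ell2 I" for f
    by (intro summable_on_cmult_right has_sum_imp_summable[OF sums[OF f]])
  have sum_lhs: "(\<lambda>i. (cmod (matrix_op I M f i))\<^sup>2) summable_on I" if f: "f \<in> ell2 I" for f
    by (rule summable_on_comparison_test[OF sum_rhs[OF f]]) (use pt[OF f] in auto)
  have bound: "ell2_norm I (matrix_op I M f) \<le> (C * real (card G)) * ell2_norm I f"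
    if f: "f \<in> ell2 I" for f
  proof -
    have "(\<Sum>\<^sub>\<infinity>i\<in>I. (cmod (matrix_op I M f i))\<^sup>2)
        \<le> (\<Sum>\<^sub>\<infinity>i\<in>I. ?K * (\<Sum>g\<in>G. (cmod (f (g i)))\<^sup>2))"
      by (rule infsum_mono[OF sum_lhs[OF f] sum_rhs[OF f] pt[OF f]])
    also have "\<dots> = ?K * (\<Sum>g\<in>G. \<Sum>\<^sub>\<infinity>i\<in>I. (cmod (f (g i)))\<^sup>2)"
      by (simp add: infsum_cmult_right' infsumI[OF sums[OF f]])
    also have "\<dots> \<le> ?K * (\<Sum>g\<in>G. \<Sum>\<^sub>\<infinity>i\<in>I. (cmod (f i))\<^sup>2)"
      by (intro mult_left_mono sum_mono ell2_reindex(2)[OF f] G(2)) auto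
    also have "\<dots> = (C * real (card G))\<^sup>2 * (\<Sum>\<^sub>\<infinity>i\<in>I. (cmod (f i))\<^sup>2)"
      by (simp add: power2_eq_square)
    finally have "ell2_norm I (matrix_op I M f)
        \<le> sqrt ((C * real (card G))\<^sup>2 * (\<Sum>\<^sub>\<infinity>i\<in>I. (cmod (f i))\<^sup>2))"
      unfolding ell2_norm_def by (rule real_sqrt_le_mono)
    then show ?thesis
      using C0 by (simp add: ell2_norm_def real_sqrt_mult)
  qed
  have add: "matrix_op I M (\<lambda>i. f i + g i) = (\<lambda>i. matrix_op I M f i + matrix_op I M g i)"
    if "f \<in> ell2 I" "g \<in> ell2 I" for f g
  proof
    fix i
    show "matrix_op I M (\<lambda>i. f i + g i) i = matrix_op I M f i + matrix_op I M g i"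
      by (cases "i \<in> I")
        (simp_all add: row outside ell2_zero_outside[OF that(1)] ell2_zero_outside[OF that(2)]
          distrib_left sum.distrib)
  qed
  have scale: "matrix_op I M (\<lambda>i. c * f i) = (\<lambda>i. c * matrix_op I M f i)"
    if "f \<in> ell2 I" for c f
  proof
    fix i
    show "matrix_op I M (\<lambda>i. c * f i) i = c * matrix_op I M f i"
      by (cases "i \<in> I")
        (simp_all add: row outside ell2_zero_outside[OF that] sum_distrib_left mult_ac)
  qed
  have "matrix_op I M f \<in> ell2 I" if "f \<in> ell2 I" for f
    using sum_lhs[OF that] outside by (simp add: ell2_def)
  then show ?thesis
    unfolding bounded_op_def using bound add scale by blast
qed

lemma toeplitz_entry_bounded:
  assumes "k \<ge> 1"
  obtains C where "0 \<le> C" "\<And>m n. cmod (toeplitz_entry k a b m n) \<le> C"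
proof
  let ?C = "\<Sum>i\<in>{1..k}. cmod (a i) + cmod (b i)"
  have *: "cmod (a i) + cmod (b i) \<le> ?C" if "i \<in> {1..k}" for i
    using that by (intro member_le_sum) auto
  have **: "cmod (periodic_ext k a n) \<le> ?C \<and> cmod (periodic_ext k b n) \<le> ?C" for n
  proof -
    have "(n - 1) mod k + 1 \<in> {1..k}"
      using assms by (simp add: Suc_leI)
    from *[OF this] show ?thesis
      unfolding periodic_ext_def
      by (smt (verit) norm_ge_zero)
  qed
  show C0: "0 \<le> ?C"
    by (intro sum_nonneg) auto
  show "cmod (toeplitz_entry k a b m n) \<le> ?C" for m n
    using ** C0 by (simp add: toeplitz_entry_def)
qed

lemma bounded_op_toeplitz_op:
  assumes "k \<ge> 1"
  shows "bounded_op {1..} (toeplitz_op k a b)"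
proof -
  obtain C where C: "\<And>m n. cmod (toeplitz_entry k a b m n) \<le> C"
    using toeplitz_entry_bounded[OF assms] by blast
  show ?thesis
    unfolding toeplitz_op_def
    by (rule bounded_op_matrix_op[where G = "{\<lambda>i. i, \<lambda>i. i + 1, \<lambda>i. i - 1}", OF _ _ _ C])
      (auto simp: toeplitz_entry_def inj_on_def split: if_splits)
qed

lemma bounded_op_interface_op:
  assumes "k \<ge> 1"
  shows "bounded_op UNIV (interface_op k a b \<eta> q)"
proof -
  obtain C where C0: "0 \<le> C" and C: "\<And>m n. cmod (toeplitz_entry k a b m n) \<le> C"
    using toeplitz_entry_bounded[OF assms] by blast
  have C': "cmod (interface_entry k a b \<eta> q i j) \<le> C + cmod \<eta> + cmod q" for i j
    using C0 C[of "nat i" "nat j"] C[of "nat (- i)" "nat (- j)"]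
      norm_ge_zero[of \<eta>] norm_ge_zero[of q]
    unfolding interface_entry_def by (smt (verit) norm_zero)
  show ?thesis
    unfolding interface_op_def
    by (rule bounded_op_matrix_op[where G = "{\<lambda>i. i, \<lambda>i. i + 1, \<lambda>i. i - 1}", OF _ _ _ C'])
      (auto simp: interface_entry_def toeplitz_entry_def inj_on_def split: if_splits)
qed

end

theory Submission
  imports Defs
begin

text \<open>
  Odd extension \<open>E\<close> embeds \<open>\<ell>\<^sup>2(\<nat>)\<close> into \<open>\<ell>\<^sup>2(\<int>)\<close>, and taking the odd part gives a left inverse
  \<open>R\<close>. The reflection symmetry yields \<open>T\<^sub>A\<^sub>B E = E T\<^sub>A\<close> and \<open>R T\<^sub>A\<^sub>B = T\<^sub>A R\<close>: the coupling \<open>q\<close> to the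
  site \<open>0\<close> is never seen by odd sequences. Hence an inverse \<open>S\<close> of \<open>T\<^sub>A\<^sub>B - \<mu>\<close> compresses to the
  inverse \<open>R S E\<close> of \<open>T\<^sub>A - \<mu>\<close>, and \<open>E\<close> maps eigenvectors to eigenvectors.
\<close>

section \<open>Bounded maps between two sequence spaces and transfer of invertibility\<close>

text \<open>\<open>bounded_op\<close> has a single index set, whereas odd extension and odd part
  change it; two index sets are needed to compose them with an inverse.\<close>

definition bounded_map ::
    "'i set \<Rightarrow> 'j set \<Rightarrow> (('i \<Rightarrow> complex) \<Rightarrow> ('j \<Rightarrow> complex)) \<Rightarrow> bool" where
  "bounded_map I J T \<longleftrightarrow>
     (\<forall>f\<in>ell2 I. T f \<in> ell2 J) \<and>
     (\<forall>f\<in>ell2 I. \<forall>g\<in>ell2 I. T (\<lambda>i. f i + g i) = (\<lambda>i. T f i + T g i)) \<and>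
     (\<forall>c. \<forall>f\<in>ell2 I. T (\<lambda>i. c * f i) = (\<lambda>i. c * T f i)) \<and>
     (\<exists>C. \<forall>f\<in>ell2 I. ell2_norm J (T f) \<le> C * ell2_norm I f)"

lemma bounded_op_iff_bounded_map: "bounded_op I T \<longleftrightarrow> bounded_map I I T"
  by (simp add: bounded_op_def bounded_map_def)

lemma ell2_norm_nonneg: "0 \<le> ell2_norm I f"
  by (simp add: ell2_norm_def infsum_nonneg)

lemma bounded_map_compose:
  assumes S: "bounded_map I J S" and T: "bounded_map J K T"
  shows "bounded_map I K (\<lambda>f. T (S f))"
proof -
  obtain C where C: "\<forall>f\<in>ell2 I. ell2_norm J (S f) \<le> C * ell2_norm I f"
    using S unfolding bounded_map_def by blast
  obtain D where D: "\<forall>f\<in>ell2 J. ell2_norm K (T f) \<le> D * ell2_norm J f"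
    using T unfolding bounded_map_def by blast
  have S_mem: "S f \<in> ell2 J" if "f \<in> ell2 I" for f
    using S that by (simp add: bounded_map_def)
  have "ell2_norm K (T (S f)) \<le> (\<bar>D\<bar> * C) * ell2_norm I f" if f: "f \<in> ell2 I" for f
  proof -
    have "ell2_norm K (T (S f)) \<le> D * ell2_norm J (S f)"
      using D S_mem[OF f] by blast
    \<comment> \<open>The constant \<open>D\<close> may be negative, so \<open>\<bar>D\<bar>\<close>
      is used to multiply the next estimate monotonically.\<close>
    also have "\<dots> \<le> \<bar>D\<bar> * ell2_norm J (S f)"
      by (intro mult_right_mono ell2_norm_nonneg) simp
    also have "\<dots> \<le> \<bar>D\<bar> * (C * ell2_norm I f)"
      using C f by (intro mult_left_mono) auto
    finally show ?thesis by (simp add: mult.assoc)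
  qed
  then show ?thesis
    using S T S_mem unfolding bounded_map_def by auto
qed

text \<open>With \<open>S\<close> the inverse of \<open>T'\<close>, the compression
  \<open>R S E\<close> inverts \<open>T\<close>: \<open>TE\<close> gives R S E T = R S T' E = R E =
  id, and \<open>RT\<close> gives T R S E = R T' S E = R E = id. Only \<open>R E\<close> has to be
  the identity, so \<open>E\<close> may fail to be onto.\<close>

lemma op_invertible_retract:
  assumes E: "bounded_map I J E" and R: "bounded_map J I R"
    and RE: "\<And>f. f \<in> ell2 I \<Longrightarrow> R (E f) = f"
    and TE: "\<And>f. f \<in> ell2 I \<Longrightarrow> T' (E f) = E (T f)"
    and RT: "\<And>w. w \<in> ell2 J \<Longrightarrow> R (T' w) = T (R w)"
    and inv: "op_invertible J T'"
  shows "op_invertible I T"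
proof -
  obtain S where S: "bounded_map J J S" and inv_S: "\<forall>w\<in>ell2 J. S (T' w) = w \<and> T' (S w) = w"
    using inv unfolding op_invertible_def bounded_op_iff_bounded_map by blast
  have E_mem: "E f \<in> ell2 J" if "f \<in> ell2 I" for f
    using E that by (simp add: bounded_map_def)
  have S_mem: "S w \<in> ell2 J" if "w \<in> ell2 J" for w
    using S that by (simp add: bounded_map_def)
  have "R (S (E (T f))) = f \<and> T (R (S (E f))) = f" if f: "f \<in> ell2 I" for f
    using inv_S E_mem[OF f] S_mem[OF E_mem[OF f]] RE[OF f] TE[OF f] RT by metis
  moreover have "bounded_map I I (\<lambda>f. R (S (E f)))"
    using bounded_map_compose[OF bounded_map_compose[OF E S] R] .
  ultimately show ?thesis
    unfolding op_invertible_def bounded_op_iff_bounded_map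
    by (intro exI[of _ "\<lambda>f. R (S (E f))"]) blast
qed

section \<open>Odd extension and odd part\<close>

definition odd_ext :: "(nat \<Rightarrow> complex) \<Rightarrow> int \<Rightarrow> complex" where
  "odd_ext f i = of_int (sgn i) * f (nat \<bar>i\<bar>)"

text \<open>The factor 1/2 makes this a left inverse of \<open>odd_ext\<close>. The value at 0 is
  automatically 0, as membership in \<open>ell2 {1..}\<close> demands.\<close>

definition odd_part :: "(int \<Rightarrow> complex) \<Rightarrow> nat \<Rightarrow> complex" where
  "odd_part w n = (w (int n) - w (- int n)) / 2"

lemma odd_part_odd_ext:
  assumes "f \<in> ell2 {1..}"
  shows "odd_part (odd_ext f) = f"
proof
  fix n show "odd_part (odd_ext f) n = f n"
    \<comment> \<open>Every odd part vanishes at 0, so the case \<open>n = 0\<close> rests on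
      \<open>f 0 = 0\<close>.\<close>
    using ell2_zero_outside[OF assms, of 0]
    by (cases "n = 0") (simp_all add: odd_part_def odd_ext_def)
qed

text \<open>Each half-line is a reindexed copy of \<open>{1..}\<close> contributing
  \<open>s\<close>, and the origin contributes 0. This is the source of the norm factor
  \<open>sqrt 2\<close> below.\<close>

lemma has_sum_odd_ext:
  assumes "((\<lambda>n. (cmod (f n))\<^sup>2) has_sum s) {1..}"
  shows "((\<lambda>i. (cmod (odd_ext f i))\<^sup>2) has_sum (s + s)) UNIV"
proof -
  let ?F = "\<lambda>i. (cmod (odd_ext f i))\<^sup>2" and ?neg = "\<lambda>n. - int n"
  have sum_cong: "((\<lambda>n. (cmod (f n))\<^sup>2) has_sum s) {1..} \<longleftrightarrow>
      ((\<lambda>n. ?F (g n)) has_sum s) {1..}" if "g = int \<or> g = ?neg" for g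
    by (rule has_sum_cong) (use that in \<open>auto simp: odd_ext_def\<close>)
  have "(?F has_sum s) (int ` {1..})"
    using has_sum_reindex[of int "{1..}" ?F s] sum_cong[of int] assms by (simp add: o_def)
  moreover have "(?F has_sum s) (?neg ` {1..})"
    using has_sum_reindex[of ?neg "{1..}" ?F s] sum_cong[of ?neg] assms
    by (simp add: o_def inj_on_def)
  ultimately have "(?F has_sum (s + s)) (int ` {1..} \<union> ?neg ` {1..})"
    by (rule has_sum_Un_disjoint) auto
  moreover have "int ` {1..} \<union> ?neg ` {1..} = - {0}"
  proof -
    have "i \<in> int ` {1..} \<union> ?neg ` {1..}" if "i \<noteq> 0" for i
    proof -
      have "i = int (nat \<bar>i\<bar>) \<or> i = - int (nat \<bar>i\<bar>)" "nat \<bar>i\<bar> \<in> {1..}"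
        using that by auto
      then show ?thesis by blast
    qed
    then show ?thesis by auto
  qed
  moreover have "(?F has_sum (s + s)) (- {0}) \<longleftrightarrow> (?F has_sum (s + s)) UNIV"
    by (rule has_sum_cong_neutral) (auto simp: odd_ext_def)
  ultimately show ?thesis by simp
qed

lemma bounded_map_odd_ext: "bounded_map {1..} UNIV odd_ext"
proof -
  have sums: "((\<lambda>i. (cmod (odd_ext f i))\<^sup>2) has_sum
      (2 * (\<Sum>\<^sub>\<infinity>n\<in>{1..}. (cmod (f n))\<^sup>2))) UNIV" if "f \<in> ell2 {1..}" for f
    using has_sum_odd_ext[OF has_sum_infsum] that by (simp add: ell2_def)
  have "odd_ext f \<in> ell2 UNIV" if "f \<in> ell2 {1..}" for f
    using has_sum_imp_summable[OF sums[OF that]] by (simp add: ell2_def)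
  moreover have "ell2_norm UNIV (odd_ext f) \<le> sqrt 2 * ell2_norm {1..} f"
    if "f \<in> ell2 {1..}" for f
    using infsumI[OF sums[OF that]] by (simp add: ell2_norm_def real_sqrt_mult)
  ultimately show ?thesis
    unfolding bounded_map_def by (auto simp: odd_ext_def algebra_simps)
qed

lemma bounded_map_odd_part: "bounded_map UNIV {1..} odd_part"
proof -
  have *: "(\<lambda>n. (cmod (odd_part w n))\<^sup>2) summable_on {1..} \<and>
      (\<Sum>\<^sub>\<infinity>n\<in>{1..}. (cmod (odd_part w n))\<^sup>2) \<le> (\<Sum>\<^sub>\<infinity>i. (cmod (w i))\<^sup>2)"
    if w: "w \<in> ell2 UNIV" for w
  proof -
    let ?F = "\<lambda>i. (cmod (w i))\<^sup>2"
    have sF: "?F summable_on UNIV"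
      using w by (simp add: ell2_def)
    \<comment> \<open>Stated for any injection \<open>g\<close> in order to cover both half-lines at
      once.\<close>
    have half: "(\<lambda>n. ?F (g n)) summable_on {1..} \<and> (\<Sum>\<^sub>\<infinity>n\<in>{1..}. ?F (g n)) \<le> infsum ?F UNIV"
      if g: "inj_on g {1..}" for g :: "nat \<Rightarrow> int"
    proof -
      have s: "?F summable_on g ` {1..}"
        using sF summable_on_subset_banach by blast
      have "infsum ?F (g ` {1..}) \<le> infsum ?F UNIV"
        by (rule infsum_mono_neutral[OF s sF]) auto
      with s show ?thesis
        using summable_on_reindex[OF g, of ?F] infsum_reindex[OF g, of ?F] by (simp add: o_def)
    qed
    have p: "(\<lambda>n. ?F (int n)) summable_on {1..}" "(\<Sum>\<^sub>\<infinity>n\<in>{1..}. ?F (int n)) \<le> infsum ?F UNIV"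
      using half[of int] by auto
    have m: "(\<lambda>n. ?F (- int n)) summable_on {1..}"
      "(\<Sum>\<^sub>\<infinity>n\<in>{1..}. ?F (- int n)) \<le> infsum ?F UNIV"
      using half[of "\<lambda>n. - int n"] by (auto simp: inj_on_def)
    have pt: "(cmod (odd_part w n))\<^sup>2 \<le> 1/2 * (?F (int n) + ?F (- int n))" for n
    proof -
      let ?x = "cmod (w (int n))" and ?y = "cmod (w (- int n))"
      have "cmod (odd_part w n) \<le> (?x + ?y) / 2"
        by (simp add: odd_part_def norm_divide norm_triangle_ineq4)
      then have "(cmod (odd_part w n))\<^sup>2 \<le> ((?x + ?y) / 2)\<^sup>2"
        by (intro power_mono) auto
      \<comment> \<open>Convexity of the square, from (x - y)^2 \<ge> 0.\<close>
      also have "\<dots> \<le> 1/2 * (?x\<^sup>2 + ?y\<^sup>2)"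
        using zero_le_power2[of "?x - ?y"] by (simp add: power2_eq_square field_simps)
      finally show ?thesis .
    qed
    have s: "(\<lambda>n. 1/2 * (?F (int n) + ?F (- int n))) summable_on {1..}"
      by (intro summable_on_cmult_right summable_on_add p m)
    have s': "(\<lambda>n. (cmod (odd_part w n))\<^sup>2) summable_on {1..}"
      by (rule summable_on_comparison_test[OF s pt]) auto
    have "(\<Sum>\<^sub>\<infinity>n\<in>{1..}. (cmod (odd_part w n))\<^sup>2) \<le>
        (\<Sum>\<^sub>\<infinity>n\<in>{1..}. 1/2 * (?F (int n) + ?F (- int n)))"
      by (rule infsum_mono[OF s' s pt])
    also have "\<dots> = 1/2 * ((\<Sum>\<^sub>\<infinity>n\<in>{1..}. ?F (int n)) + (\<Sum>\<^sub>\<infinity>n\<in>{1..}. ?F (- int n)))"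
      using infsum_add[OF p(1) m(1)] by (subst infsum_cmult_right') simp
    \<comment> \<open>Each half-line sum is bounded by the full sum, which gives the simple norm
      constant 1.\<close>
    also have "\<dots> \<le> infsum ?F UNIV"
      using p m by simp
    finally show ?thesis using s' by simp
  qed
  have "odd_part w \<in> ell2 {1..}" if "w \<in> ell2 UNIV" for w
    using *[OF that] by (auto simp: ell2_def odd_part_def not_le)
  moreover have "ell2_norm {1..} (odd_part w) \<le> 1 * ell2_norm UNIV w" if "w \<in> ell2 UNIV" for w
    using *[OF that] by (simp add: ell2_norm_def)
  ultimately show ?thesis
    unfolding bounded_map_def
    by (auto simp: odd_part_def add_divide_distrib diff_divide_distrib algebra_simps
      intro!: exI[of _ 1])
qed

section \<open>Rows of the two operators and the intertwining relations\<close>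

text \<open>For \<open>n = 1\<close> the left neighbour is the index 0 outside \<open>{1..}\<close>,
  and the entry there is an artefact of truncated subtraction. The condition \<open>f 0 = 0\<close>
  removes that term, so one formula serves all rows.\<close>

lemma toeplitz_op_row:
  assumes "n \<ge> 1" "f 0 = 0"
  shows "toeplitz_op k a b f n = toeplitz_entry k a b n (n - 1) * f (n - 1)
    + periodic_ext k a n * f n + periodic_ext k b n * f (n + 1)"
proof -
  have "toeplitz_op k a b f n = (\<Sum>\<^sub>\<infinity>j\<in>{1..}. toeplitz_entry k a b n j * f j)"
    using assms by (simp add: toeplitz_op_def matrix_op_def)
  also have "\<dots> = (\<Sum>\<^sub>\<infinity>j\<in>{n - 1, n, n + 1}. toeplitz_entry k a b n j * f j)"
    by (rule infsum_cong_neutral)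
      (use assms in \<open>auto simp: toeplitz_entry_def not_le split: if_splits\<close>)
  also have "\<dots> = toeplitz_entry k a b n (n - 1) * f (n - 1)
      + periodic_ext k a n * f n + periodic_ext k b n * f (n + 1)"
    using assms by (simp add: toeplitz_entry_def)
  finally show ?thesis .
qed

lemma interface_op_row:
  "interface_op k a b \<eta> q w i = interface_entry k a b \<eta> q i (i - 1) * w (i - 1)
    + interface_entry k a b \<eta> q i i * w i + interface_entry k a b \<eta> q i (i + 1) * w (i + 1)"
proof -
  have "interface_op k a b \<eta> q w i = (\<Sum>\<^sub>\<infinity>j. interface_entry k a b \<eta> q i j * w j)"
    by (simp add: interface_op_def matrix_op_def)
  also have "\<dots> = (\<Sum>\<^sub>\<infinity>j\<in>{i - 1, i, i + 1}. interface_entry k a b \<eta> q i j * w j)"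
    by (rule infsum_cong_neutral)
      (auto simp: interface_entry_def toeplitz_entry_def split: if_splits)
  finally show ?thesis by (simp add: add.assoc)
qed

text \<open>Both neighbours of the origin carry the same weight \<open>q\<close>, so this row
  vanishes on odd sequences.\<close>

lemma interface_op_zero:
  "interface_op k a b \<eta> q w 0 = q * w (-1) + \<eta> * w 0 + q * w 1"
  by (simp add: interface_op_row interface_entry_def)

lemma interface_op_pos:
  assumes "n \<ge> 1"
  shows "interface_op k a b \<eta> q w (int n) =
    (if n = 1 then q else toeplitz_entry k a b n (n - 1)) * w (int n - 1)
    + periodic_ext k a n * w (int n) + periodic_ext k b n * w (int n + 1)"
  using assms
  by (auto simp: interface_op_row interface_entry_def toeplitz_entry_def nat_diff_distrib nat_add_distrib)

text \<open>The indices are written as negatives of those in \<open>interface_op_pos\<close>. The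
  coefficients coincide, which is the reflection symmetry, so subtracting the two rows produces odd
  parts term by term.\<close>

lemma interface_op_neg:
  assumes "n \<ge> 1"
  shows "interface_op k a b \<eta> q w (- int n) =
    (if n = 1 then q else toeplitz_entry k a b n (n - 1)) * w (- (int n - 1))
    + periodic_ext k a n * w (- int n) + periodic_ext k b n * w (- (int n + 1))"
  using assms
  by (auto simp: interface_op_row interface_entry_def toeplitz_entry_def nat_diff_distrib nat_add_distrib)

lemma odd_part_interface_op:
  "odd_part (interface_op k a b \<eta> q w) = toeplitz_op k a b (odd_part w)"
proof
  fix n show "odd_part (interface_op k a b \<eta> q w) n = toeplitz_op k a b (odd_part w) n"
  proof (cases "n = 0")
    case True
    then show ?thesis
      by (simp add: odd_part_def toeplitz_op_def matrix_op_def)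
  next
    case False
    then have n: "n \<ge> 1" by simp
    have n': "int (n - 1) = int n - 1" "int (n + 1) = int n + 1" using n by auto
    have row: "toeplitz_op k a b (odd_part w) n =
        toeplitz_entry k a b n (n - 1) * odd_part w (n - 1)
        + periodic_ext k a n * odd_part w n + periodic_ext k b n * odd_part w (n + 1)"
      by (rule toeplitz_op_row[OF n]) (simp add: odd_part_def)
    show ?thesis
      \<comment> \<open>For \<open>n = 1\<close> both mirrored rows contain \<open>q * w 0\<close>,
        which cancels; on the Toeplitz side the matching term has the factor
        \<open>odd_part w 0 = 0\<close>.\<close>
      unfolding row unfolding odd_part_def n' interface_op_pos[OF n] interface_op_neg[OF n]
      by (simp add: field_simps)
  qed
qed

lemma interface_op_odd_ext:
  assumes "f 0 = 0"
  shows "interface_op k a b \<eta> q (odd_ext f) = odd_ext (toeplitz_op k a b f)"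
proof
  fix i :: int
  consider "i = 0" | n where "n \<ge> 1" "i = int n" | n where "n \<ge> 1" "i = - int n"
    by (metis One_nat_def Suc_leI int_cases2 neg_equal_0_iff_equal of_nat_0 not_gr_zero)
  then show "interface_op k a b \<eta> q (odd_ext f) i = odd_ext (toeplitz_op k a b f) i"
  proof cases
    case 1
    then show ?thesis by (simp add: interface_op_zero odd_ext_def)
  next
    case (2 n)
    \<comment> \<open>The factor \<open>of_bool (n \<noteq> 1)\<close> records that the inner
      neighbour of site 1 is the origin, where the odd extension is 0; it removes the coupling
      \<open>q\<close>.\<close>
    have "nat \<bar>int n - 1\<bar> = n - 1" "nat \<bar>int n + 1\<bar> = n + 1" "sgn (int n - 1) = of_bool (n \<noteq> 1)"
      using 2 by (auto simp: sgn_if)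
    then show ?thesis
      unfolding 2(2) interface_op_pos[OF 2(1)]
      using 2 toeplitz_op_row[of n f k a b] assms by (simp add: odd_ext_def)
  next
    case (3 n)
    have "nat \<bar>- (int n - 1)\<bar> = n - 1" "nat \<bar>- (int n + 1)\<bar> = n + 1"
      "sgn (- (int n - 1)) = - of_bool (n \<noteq> 1)" "sgn (- (int n + 1)) = - 1"
      using 3 by (auto simp: sgn_if)
    then show ?thesis
      unfolding 3(2) interface_op_neg[OF 3(1)] odd_ext_def
      using 3 toeplitz_op_row[of n f k a b] assms by simp
  qed
qed

section \<open>Eigenvectors and spectra\<close>

lemma eigenvector_of_odd_ext:
  assumes "eigenvector_of {1..} (toeplitz_op k a b) \<mu> v"
  shows "eigenvector_of UNIV (interface_op k a b \<eta> q) \<mu> (odd_ext v)"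
proof -
  have v: "v \<in> ell2 {1..}" and nz: "v \<noteq> (\<lambda>i. 0)" and ev: "toeplitz_op k a b v = (\<lambda>i. \<mu> * v i)"
    using assms by (auto simp: eigenvector_of_def)
  \<comment> \<open>The left inverse \<open>odd_part\<close> recovers \<open>v\<close>, so a
    vanishing extension would force \<open>v\<close> to vanish.\<close>
  have "odd_ext v \<noteq> (\<lambda>i. 0)"
  proof
    assume "odd_ext v = (\<lambda>i. 0)"
    then have "v = odd_part (\<lambda>i. 0)"
      using odd_part_odd_ext[OF v] by simp
    also have "\<dots> = (\<lambda>n. 0)"
      by (rule ext) (simp add: odd_part_def)
    finally show False using nz by simp
  qed
  moreover have "interface_op k a b \<eta> q (odd_ext v) = (\<lambda>i. \<mu> * odd_ext v i)"
    using interface_op_odd_ext[of v k a b \<eta> q] ell2_zero_outside[OF v, of 0]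
    by (auto simp: ev odd_ext_def)
  moreover have "odd_ext v \<in> ell2 UNIV"
    using bounded_map_odd_ext v by (simp add: bounded_map_def)
  ultimately show ?thesis
    by (simp add: eigenvector_of_def)
qed

lemma toeplitz_spectrum_subset_interface_spectrum:
  "op_spectrum {1..} (toeplitz_op k a b) \<subseteq> op_spectrum UNIV (interface_op k a b \<eta> q)"
proof -
  \<comment> \<open>The inclusion is proved by contraposition. Both intertwining relations survive
    the shift by \<open>\<mu>\<close> because odd extension and odd part are linear.\<close>
  have "op_invertible {1..} (\<lambda>f i. toeplitz_op k a b f i - \<mu> * f i)"
    if "op_invertible UNIV (\<lambda>w i. interface_op k a b \<eta> q w i - \<mu> * w i)" for \<mu>
  proof (rule op_invertible_retract[OF bounded_map_odd_ext bounded_map_odd_part _ _ _ that])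
    fix f :: "nat \<Rightarrow> complex" assume f: "f \<in> ell2 {1..}"
    show "odd_part (odd_ext f) = f"
      using f by (rule odd_part_odd_ext)
    show "(\<lambda>i. interface_op k a b \<eta> q (odd_ext f) i - \<mu> * odd_ext f i) =
        odd_ext (\<lambda>i. toeplitz_op k a b f i - \<mu> * f i)"
      using interface_op_odd_ext[of f k a b \<eta> q] ell2_zero_outside[OF f, of 0]
      by (auto simp: odd_ext_def algebra_simps)
  next
    fix w :: "int \<Rightarrow> complex"
    have "odd_part (\<lambda>i. interface_op k a b \<eta> q w i - \<mu> * w i) =
        (\<lambda>n. odd_part (interface_op k a b \<eta> q w) n - \<mu> * odd_part w n)"
      by (auto simp: odd_part_def field_simps)
    then show "odd_part (\<lambda>i. interface_op k a b \<eta> q w i - \<mu> * w i) =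
        (\<lambda>n. toeplitz_op k a b (odd_part w) n - \<mu> * odd_part w n)"
      by (simp add: odd_part_interface_op)
  qed
  then show ?thesis
    by (auto simp: op_spectrum_def)
qed

theorem theorem3p7:
  fixes k :: nat and a b :: "nat \<Rightarrow> complex" and \<eta> q :: complex
  assumes "k \<ge> 1"
    and "\<And>i. i \<in> {1..k} \<Longrightarrow> b i \<noteq> 0"
    and "q \<noteq> 0"
  shows "op_spectrum {1..} (toeplitz_op k a b) \<subseteq> op_spectrum UNIV (interface_op k a b \<eta> q)
    \<and> (\<forall>v \<mu>. eigenvector_of {1..} (toeplitz_op k a b) \<mu> v \<and> v 1 \<noteq> 0 \<longrightarrow>
        (\<exists>w. eigenvector_of UNIV (interface_op k a b \<eta> q) \<mu> w \<and>
          (\<forall>i. w i = (if i < 0 then - v (nat \<bar>i\<bar>) else if i = 0 then 0 else v (nat i)))))"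
proof (intro conjI allI impI)
  show "op_spectrum {1..} (toeplitz_op k a b) \<subseteq> op_spectrum UNIV (interface_op k a b \<eta> q)"
    by (rule toeplitz_spectrum_subset_interface_spectrum)
next
  fix v \<mu> assume "eigenvector_of {1..} (toeplitz_op k a b) \<mu> v \<and> v 1 \<noteq> 0"
  then show "\<exists>w. eigenvector_of UNIV (interface_op k a b \<eta> q) \<mu> w \<and>
      (\<forall>i. w i = (if i < 0 then - v (nat \<bar>i\<bar>) else if i = 0 then 0 else v (nat i)))"
    by (intro exI[of _ "odd_ext v"]) (auto simp: eigenvector_of_odd_ext odd_ext_def)
qed

end
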